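(* Let $\mathcal{U}=\{U_k\}_{k\in\mathbb{N}}$ and $\mathcal{V}=\{V_l\}_{l\in\mathbb{N}}$ be sequences of sets, and let $\mathbf{C}$ be the class of all $(\mathcal{U},\mathcal{V})$-computable partial functions from $\bigcup_{k=0}^\infty U_k$ to $\bigcup_{l=0}^\infty V_l$. Let $\mathcal{A}$ be a finite collection of subsets of $\bigcup_{k=0}^\infty U_k$. If, for each subcollection $\mathcal{K}\subseteq\mathcal{A}$, some effective $\hat{\mathcal{U}}$-union separates $\bigcup\mathcal{K}\setminus\bigcup(\mathcal{A}\setminus\mathcal{K})$ from $\bigcup(\mathcal{A}\setminus\mathcal{K})\setminus\bigcup\mathcal{K}$, then $\mathcal{A}$ is strongly join permitting for $\mathbf{C}$. Moreover, if there exist natural numbers $l_1,l_2$ such that each of the sets $V_{l_1}$ and $V_{l_2}\setminus V_{l_1}$ contains some $\mathcal{V}$-computable element, then the converse also holds.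
   Context: For a sequence $\mathcal{U}=\{U_k\}_{k\in\mathbb{N}}$ of sets and $x\in\bigcup_k U_k$, let $\mathcal{U}^{-1}(x)=\{k\in\mathbb{N}\mid x\in U_k\}$; the total enumerations (total functions $\mathbb{N}\to\mathbb{N}$ with range $\mathcal{U}^{-1}(x)$) of this set are the $\mathcal{U}$-names of $x$; $x$ is $\mathcal{U}$-computable if $\mathcal{U}^{-1}(x)$ is recursively enumerable. Let $D_0,D_1,\dots$ be the canonical enumeration of all finite subsets of $\mathbb{N}$, and $\hat U_m=\bigcap_{k\in D_m}U_k$, with the empty intersection taken to be $\bigcup_{k}U_k$; $\hat{\mathcal{U}}=\{\hat U_m\}_{m\in\mathbb{N}}$. An effective $\hat{\mathcal{U}}$-union is a set of the form $\bigcup_{m\in S}\hat U_m$ with $S\subseteq\mathbb{N}$ recursively enumerable. A partial function $f$ from $\bigcup_k U_k$ to $\bigcup_l V_l$ is $(\mathcal{U},\mathcal{V})$-computable if there is a recursive operator $\Gamma$ (on total functions $\mathbb{N}\to\mathbb{N}$) such that for every $x\in\mathrm{dom}(f)$, $\Gamma$ transforms every $\mathcal{U}$-name of $x$ into a $\mathcal{V}$-name of $f(x)$. Functions are sets of ordered pairs; $f\!\upharpoonright_A$ is the restriction of $f$ to $A\cap\mathrm{dom}(f)$. For a class $\mathbf{C}$ of functions, a collection $\mathcal{A}$ of sets is strongly join permitting for $\mathbf{C}$ if for every function $f$ with $\mathrm{dom}(f)\subseteq\bigcup\mathcal{A}$: if $f\!\upharpoonright_A\in\mathbf{C}$ for all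 $A\in\mathcal{A}$, then $f\in\mathbf{C}$. $\bigcup\mathcal{K}$ is the union of the members of $\mathcal{K}$ (empty if $\mathcal{K}=\varnothing$). A set $H$ separates $P$ from $Q$ if $H\supseteq P$ and $H\cap Q=\varnothing$. *)

theory Defs
  imports Main "HOL-Library.Nat_Bijection"
begin

text \<open>
  General recursive functions in Kleene's sense: minimization is applied to regular functions
  only, so every function is total.  An \<open>n\<close>-ary function is represented on lists; its values
  on lists of length other than \<open>n\<close> are junk.
\<close>

inductive recursive :: "nat \<Rightarrow> (nat list \<Rightarrow> nat) \<Rightarrow> bool" where
  zero: "recursive n (\<lambda>xs. 0)"
| succ: "recursive 1 (\<lambda>xs. Suc (hd xs))"
| proj: "i < n \<Longrightarrow> recursive n (\<lambda>xs. xs ! i)"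
| comp: "recursive (length gs) f \<Longrightarrow> (\<forall>g\<in>set gs. recursive n g) \<Longrightarrow>
    recursive n (\<lambda>xs. f (map (\<lambda>g. g xs) gs))"
| prim: "recursive n f \<Longrightarrow> recursive (n + 2) g \<Longrightarrow>
    recursive (Suc n) (\<lambda>xs. rec_nat (f (tl xs)) (\<lambda>k r. g (k # r # tl xs)) (hd xs))"
| mu: "recursive (Suc n) f \<Longrightarrow> (\<forall>xs. length xs = n \<longrightarrow> (\<exists>k. f (k # xs) = 0)) \<Longrightarrow>
    recursive n (\<lambda>xs. LEAST k. f (k # xs) = 0)"

definition recursive_fun :: "(nat \<Rightarrow> nat) \<Rightarrow> bool" where
  "recursive_fun f \<longleftrightarrow> (\<exists>F. recursive 1 F \<and> (\<forall>n. f n = F [n]))"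

definition recursively_enumerable :: "nat set \<Rightarrow> bool" where
  "recursively_enumerable S \<longleftrightarrow> S = {} \<or> (\<exists>f. recursive_fun f \<and> S = range f)"

text \<open>
  Recursive operators following Rogers: the graph of the result is obtained from the graph of
  the argument by an enumeration operator.  The canonical enumeration
  \<open>D\<^sub>0, D\<^sub>1, \<dots>\<close> of the finite sets is \<^const>\<open>set_decode\<close>.  The result may be a properly
  partial function (as for an oracle computation that need not halt).  Arguments are total; as
  enumeration operators are monotone and every partial function has a total extension, one that
  produces single-valued graphs from all total functions does so from all partial ones.
\<close>

definition enum_operator :: "nat set \<Rightarrow> nat set \<Rightarrow> nat set" where
  "enum_operator W B = {z. \<exists>m. prod_encode (z, m) \<in> W \<and> set_decode m \<subseteq> B}"

definition recursive_operator :: "((nat \<Rightarrow> nat) \<Rightarrow> (nat \<rightharpoonup> nat)) \<Rightarrow> bool" where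
  "recursive_operator \<Gamma> \<longleftrightarrow>
    (\<exists>W. recursively_enumerable W \<and>
      (\<forall>g. {prod_encode (n, l) |n l. \<Gamma> g n = Some l} =
        enum_operator W {prod_encode (n, g n) |n. True}))"

definition indices :: "(nat \<Rightarrow> 'a set) \<Rightarrow> 'a \<Rightarrow> nat set" where
  "indices U x = {k. x \<in> U k}"

definition is_name :: "(nat \<Rightarrow> 'a set) \<Rightarrow> 'a \<Rightarrow> (nat \<Rightarrow> nat) \<Rightarrow> bool" where
  "is_name U x g \<longleftrightarrow> x \<in> (\<Union>k. U k) \<and> range g = indices U x"

definition computable_element :: "(nat \<Rightarrow> 'a set) \<Rightarrow> 'a \<Rightarrow> bool" where
  "computable_element U x \<longleftrightarrow> x \<in> (\<Union>k. U k) \<and> recursively_enumerable (indices U x)"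

definition hat :: "(nat \<Rightarrow> 'a set) \<Rightarrow> nat \<Rightarrow> 'a set" where
  "hat U m = (if set_decode m = {} then (\<Union>k. U k) else (\<Inter>k\<in>set_decode m. U k))"

definition effective_union :: "(nat \<Rightarrow> 'a set) \<Rightarrow> 'a set \<Rightarrow> bool" where
  "effective_union W H \<longleftrightarrow> (\<exists>S. recursively_enumerable S \<and> H = (\<Union>m\<in>S. W m))"

definition computable_fun ::
    "(nat \<Rightarrow> 'a set) \<Rightarrow> (nat \<Rightarrow> 'b set) \<Rightarrow> ('a \<rightharpoonup> 'b) \<Rightarrow> bool" where
  "computable_fun U V f \<longleftrightarrow>
    dom f \<subseteq> (\<Union>k. U k) \<and> ran f \<subseteq> (\<Union>l. V l) \<and>
    (\<exists>\<Gamma>. recursive_operator \<Gamma> \<and>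
      (\<forall>x y g. f x = Some y \<longrightarrow> is_name U x g \<longrightarrow>
        (\<exists>h. \<Gamma> g = (\<lambda>n. Some (h n)) \<and> is_name V y h)))"

definition strongly_join_permitting :: "('a \<rightharpoonup> 'b) set \<Rightarrow> 'a set set \<Rightarrow> bool" where
  "strongly_join_permitting C \<A> \<longleftrightarrow>
    (\<forall>f. dom f \<subseteq> \<Union>\<A> \<longrightarrow> (\<forall>A\<in>\<A>. f |` A \<in> C) \<longrightarrow> f \<in> C)"

definition separates :: "'a set \<Rightarrow> 'a set \<Rightarrow> 'a set \<Rightarrow> bool" where
  "separates H P Q \<longleftrightarrow> P \<subseteq> H \<and> H \<inter> Q = {}"

end

theory Submission
  imports Defs
begin

text \<open>
  A function is computable iff some enumeration operator maps \<open>indices U x\<close> to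
  \<open>indices V (f x)\<close>: to pass from a recursive operator to an enumeration operator, collect all
  values that it produces from finite parts of names.  Membership in an effective union is
  semidecided by an enumeration operator too, and such operators are closed under finite unions and
  intersections.  If \<open>E\<^sub>A\<close> computes the restriction of \<open>f\<close> to \<open>A\<close> and \<open>H\<^sub>\<K>\<close> are the separating
  unions, then \<open>f\<close> is computed by the union, over all \<open>\<K>\<close> with \<open>x \<in> H\<^sub>\<K>\<close>, of the intersections of
  the outputs of \<open>E\<^sub>A\<close> for \<open>A \<in> \<K>\<close>: if \<open>x \<in> H\<^sub>\<K>\<close>, then some \<open>A \<in> \<K>\<close> contains \<open>x\<close>, so the
  intersection holds correct values only, and for \<open>\<K> = {A. x \<in> A}\<close> it holds all of them.
  Conversely, the function with value \<open>y1\<close> on the first set \<open>P\<close> to be separated and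
  \<open>y2\<close> on the second set \<open>Q\<close>, where \<open>V l\<close> contains \<open>y1\<close> but
  not \<open>y2\<close>, is constant on each \<open>A \<in> \<A>\<close>, and the points where its enumeration operator outputs
  \<open>l\<close> form an effective union separating \<open>P\<close> from \<open>Q\<close>.
\<close>

section \<open>Recursive functions of several arguments\<close>

text \<open>\<open>recursive\<close> fixes the values on lists of every length, junk included.
  Comparing on lists of length \<open>n\<close> only lets the closure rules rewrite function bodies
  freely.\<close>

definition recursive_on :: "nat \<Rightarrow> (nat list \<Rightarrow> nat) \<Rightarrow> bool" where
  "recursive_on n F \<longleftrightarrow> (\<exists>G. recursive n G \<and> (\<forall>xs. length xs = n \<longrightarrow> F xs = G xs))"

lemma recursive_onI: "recursive n F \<Longrightarrow> recursive_on n F"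
  unfolding recursive_on_def by blast

lemma recursive_on_cong:
  "recursive_on n F \<Longrightarrow> (\<And>xs. length xs = n \<Longrightarrow> F' xs = F xs) \<Longrightarrow> recursive_on n F'"
  unfolding recursive_on_def by metis

lemma recursive_on_zero: "recursive_on n (\<lambda>xs. 0)"
  by (rule recursive_onI) (rule recursive.zero)

lemma recursive_on_nth: "i < n \<Longrightarrow> recursive_on n (\<lambda>xs. xs ! i)"
  by (rule recursive_onI) (rule recursive.proj)

lemma recursive_on_comp1:
  assumes "recursive_on 1 F" and "recursive_on n f"
  shows "recursive_on n (\<lambda>xs. F [f xs])"
proof -
  obtain G g where "recursive 1 G" "\<And>xs. length xs = 1 \<Longrightarrow> F xs = G xs"
    and "recursive n g" "\<And>xs. length xs = n \<Longrightarrow> f xs = g xs"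
    using assms unfolding recursive_on_def by blast
  with recursive.comp[of "[g]" G n] show ?thesis
    unfolding recursive_on_def by (intro exI[of _ "\<lambda>xs. G [g xs]"]) simp
qed

lemma recursive_on_comp2:
  assumes "recursive_on 2 F" and "recursive_on n f" and "recursive_on n f'"
  shows "recursive_on n (\<lambda>xs. F [f xs, f' xs])"
proof -
  obtain G g g' where "recursive 2 G" "\<And>xs. length xs = 2 \<Longrightarrow> F xs = G xs"
    and "recursive n g" "\<And>xs. length xs = n \<Longrightarrow> f xs = g xs"
    and "recursive n g'" "\<And>xs. length xs = n \<Longrightarrow> f' xs = g' xs"
    using assms unfolding recursive_on_def by blast
  with recursive.comp[of "[g, g']" G n] show ?thesis
    unfolding recursive_on_def
    by (intro exI[of _ "\<lambda>xs. G [g xs, g' xs]"]) (simp add: numeral_2_eq_2)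
qed

lemma recursive_on_Suc: "recursive_on n f \<Longrightarrow> recursive_on n (\<lambda>xs. Suc (f xs))"
  using recursive_on_comp1[OF recursive_onI[OF recursive.succ]] by simp

lemma recursive_on_const: "recursive_on n (\<lambda>xs. c)"
  by (induction c) (simp_all add: recursive_on_zero recursive_on_Suc)

lemma recursive_on_rec_nat:
  assumes "recursive_on n f" and "recursive_on (n + 2) g"
  shows "recursive_on (Suc n)
    (\<lambda>xs. rec_nat (f (tl xs)) (\<lambda>k r. g (k # r # tl xs)) (hd xs))"
proof -
  obtain f' g' where f': "recursive n f'" "\<And>xs. length xs = n \<Longrightarrow> f xs = f' xs"
    and g': "recursive (n + 2) g'" "\<And>xs. length xs = n + 2 \<Longrightarrow> g xs = g' xs"
    using assms unfolding recursive_on_def by blast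
  show ?thesis
    unfolding recursive_on_def
    by (intro exI[of _ "\<lambda>xs. rec_nat (f' (tl xs)) (\<lambda>k r. g' (k # r # tl xs)) (hd xs)"] conjI
        recursive.prim f'(1) g'(1))
      (simp add: f'(2) g'(2))
qed

lemma recursive_on_Least:
  assumes "recursive_on (Suc n) f" and "\<And>xs. length xs = n \<Longrightarrow> \<exists>k. f (k # xs) = 0"
  shows "recursive_on n (\<lambda>xs. LEAST k. f (k # xs) = 0)"
proof -
  obtain f' where f': "recursive (Suc n) f'" "\<And>xs. length xs = Suc n \<Longrightarrow> f xs = f' xs"
    using assms(1) unfolding recursive_on_def by blast
  show ?thesis
    unfolding recursive_on_def
    by (intro exI[of _ "\<lambda>xs. LEAST k. f' (k # xs) = 0"] conjI recursive.mu)
      (use f' assms(2) in auto)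
qed

text \<open>This rule and its binary version address arguments by position, as the instances below
  do, instead of by \<open>hd\<close> and \<open>tl\<close>.\<close>

lemma recursive_on_rec_nat1:
  assumes "recursive_on 2 (\<lambda>xs. s (xs ! 0) (xs ! 1))"
  shows "recursive_on 1 (\<lambda>xs. rec_nat c s (xs ! 0))"
proof -
  have "recursive_on (Suc 0) (\<lambda>xs. rec_nat c
      (\<lambda>k r. s ((k # r # tl xs) ! 0) ((k # r # tl xs) ! 1)) (hd xs))"
    by (rule recursive_on_rec_nat[OF recursive_on_const]) (use assms in \<open>simp add: numeral_2_eq_2\<close>)
  then have "recursive_on 1 (\<lambda>xs. rec_nat c s (hd xs))"
    by simp
  then show ?thesis
    by (rule recursive_on_cong) (simp add: hd_conv_nth flip: length_greater_0_conv)
qed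

lemma recursive_on_rec_nat2:
  assumes "recursive_on 1 (\<lambda>xs. a (xs ! 0))"
    and "recursive_on 3 (\<lambda>xs. s (xs ! 0) (xs ! 1) (xs ! 2))"
  shows "recursive_on 2 (\<lambda>xs. rec_nat (a (xs ! 1)) (\<lambda>k r. s k r (xs ! 1)) (xs ! 0))"
proof -
  have "recursive_on (Suc 1) (\<lambda>xs. rec_nat (a (tl xs ! 0))
      (\<lambda>k r. s ((k # r # tl xs) ! 0) ((k # r # tl xs) ! 1) ((k # r # tl xs) ! 2)) (hd xs))"
    by (rule recursive_on_rec_nat[OF assms(1)]) (use assms(2) in \<open>simp add: numeral_3_eq_3\<close>)
  then show ?thesis
    unfolding Suc_1
    by (rule recursive_on_cong) (simp add: hd_conv_nth nth_tl flip: length_greater_0_conv)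
qed

section \<open>Arithmetic functions\<close>

lemma recursive_on_add: "recursive_on 2 (\<lambda>xs. xs ! 0 + xs ! 1)"
proof -
  have *: "rec_nat b (\<lambda>k r. Suc r) a = a + b" for a b
    by (induction a) auto
  show ?thesis
    using recursive_on_rec_nat2[of "\<lambda>a. a" "\<lambda>k r a. Suc r"]
    by (simp add: recursive_on_Suc recursive_on_nth *)
qed

lemma recursive_on_mult: "recursive_on 2 (\<lambda>xs. xs ! 0 * xs ! 1)"
proof -
  have *: "rec_nat 0 (\<lambda>k r. r + b) a = a * b" for a b :: nat
    by (induction a) auto
  have "recursive_on 3 (\<lambda>xs. xs ! 1 + xs ! 2)"
    using recursive_on_comp2[OF recursive_on_add] recursive_on_nth[of 1 3] recursive_on_nth[of 2 3]
    by fastforce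
  then show ?thesis
    using recursive_on_rec_nat2[of "\<lambda>a. 0" "\<lambda>k r a. r + a"]
    by (simp add: recursive_on_zero *)
qed

text \<open>The predecessor is iterated with the subtrahend as recursion argument. This yields
  \<open>xs ! 1 - xs ! 0\<close>, and the arguments are swapped at the end.\<close>

lemma recursive_on_diff: "recursive_on 2 (\<lambda>xs. xs ! 0 - xs ! 1)"
proof -
  have pred: "rec_nat 0 (\<lambda>k r. k) a = a - 1" for a
    by (cases a) auto
  have "recursive_on 1 (\<lambda>xs. xs ! 0 - 1)"
    using recursive_on_rec_nat1[of "\<lambda>k r. k" 0] by (simp add: recursive_on_nth pred)
  then have "recursive_on 3 (\<lambda>xs. xs ! 1 - 1)"
    using recursive_on_comp1[of "\<lambda>xs. xs ! 0 - 1" 3 "\<lambda>xs. xs ! 1"]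
    by (simp add: recursive_on_nth)
  moreover have *: "rec_nat b (\<lambda>k r. r - 1) a = b - a" for a b :: nat
    by (induction a) auto
  ultimately have "recursive_on 2 (\<lambda>xs. xs ! 1 - xs ! 0)"
    using recursive_on_rec_nat2[of "\<lambda>a. a" "\<lambda>k r a. r - 1"]
    by (simp only: recursive_on_nth *)
  then show ?thesis
    using recursive_on_comp2[of "\<lambda>xs. xs ! 1 - xs ! 0" 2 "\<lambda>xs. xs ! 1" "\<lambda>xs. xs ! 0"]
    by (simp add: recursive_on_nth)
qed

lemma recursive_on_triangle: "recursive_on 1 (\<lambda>xs. triangle (xs ! 0))"
proof -
  have *: "rec_nat 0 (\<lambda>k r. r + Suc k) a = triangle a" for a
    by (induction a) auto
  have "recursive_on 2 (\<lambda>xs. xs ! 1 + Suc (xs ! 0))"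
    using recursive_on_comp2[OF recursive_on_add, of 2 "\<lambda>xs. xs ! 1" "\<lambda>xs. Suc (xs ! 0)"]
    by (simp add: recursive_on_nth recursive_on_Suc)
  from recursive_on_rec_nat1[OF this, of 0] show ?thesis
    by (simp only: *)
qed

lemma recursive_on_power2: "recursive_on 1 (\<lambda>xs. 2 ^ (xs ! 0))"
proof -
  have *: "rec_nat (Suc 0) (\<lambda>k r. r + r) a = 2 ^ a" for a
    by (induction a) auto
  have "recursive_on 2 (\<lambda>xs. xs ! 1 + xs ! 1)"
    using recursive_on_comp2[OF recursive_on_add, of 2 "\<lambda>xs. xs ! 1" "\<lambda>xs. xs ! 1"]
    by (simp add: recursive_on_nth)
  from recursive_on_rec_nat1[OF this, of "Suc 0"] show ?thesis
    by (simp only: *)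
qed

section \<open>Unary recursive functions and decidable predicates\<close>

text \<open>
  Functions of several arguments are treated as unary functions of coded tuples, so that the
  closure properties below are syntax-directed introduction rules.
\<close>

abbreviation pfst :: "nat \<Rightarrow> nat" where "pfst z \<equiv> fst (prod_decode z)"
abbreviation psnd :: "nat \<Rightarrow> nat" where "psnd z \<equiv> snd (prod_decode z)"

lemma recursive_fun_iff: "recursive_fun f \<longleftrightarrow> recursive_on 1 (\<lambda>xs. f (xs ! 0))"
proof
  assume "recursive_fun f"
  then show "recursive_on 1 (\<lambda>xs. f (xs ! 0))"
    unfolding recursive_fun_def recursive_on_def by (auto simp: length_Suc_conv)
next
  assume "recursive_on 1 (\<lambda>xs. f (xs ! 0))"
  then obtain G where "recursive 1 G" "\<And>xs. length xs = 1 \<Longrightarrow> f (xs ! 0) = G xs"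
    unfolding recursive_on_def by blast
  from this(1) this(2)[of "[n]" for n] show "recursive_fun f"
    unfolding recursive_fun_def by auto
qed

lemma recursive_fun_comp: "recursive_fun f \<Longrightarrow> recursive_fun g \<Longrightarrow> recursive_fun (\<lambda>x. f (g x))"
  unfolding recursive_fun_iff by (drule (1) recursive_on_comp1) simp

lemma recursive_fun_binary:
  assumes "recursive_on 2 (\<lambda>xs. F (xs ! 0) (xs ! 1))" and "recursive_fun f" and "recursive_fun g"
  shows "recursive_fun (\<lambda>x. F (f x) (g x))"
  using recursive_on_comp2[OF assms[unfolded recursive_fun_iff]]
  unfolding recursive_fun_iff by simp

lemma recursive_fun_id: "recursive_fun (\<lambda>x. x)"
  unfolding recursive_fun_iff by (simp add: recursive_on_nth)

lemma recursive_fun_const: "recursive_fun (\<lambda>x. c)"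
  unfolding recursive_fun_iff by (rule recursive_on_const)

lemma recursive_fun_Suc: "recursive_fun f \<Longrightarrow> recursive_fun (\<lambda>x. Suc (f x))"
  unfolding recursive_fun_iff by (rule recursive_on_Suc)

lemmas recursive_fun_add = recursive_fun_binary[OF recursive_on_add]
lemmas recursive_fun_mult = recursive_fun_binary[OF recursive_on_mult]
lemmas recursive_fun_diff = recursive_fun_binary[OF recursive_on_diff]
lemmas recursive_fun_triangle =
  recursive_fun_comp[OF recursive_on_triangle[folded recursive_fun_iff]]
lemmas recursive_fun_power2 =
  recursive_fun_comp[OF recursive_on_power2[folded recursive_fun_iff]]

section \<open>The Cantor pairing function and its inverse\<close>

lemma recursive_fun_prod_encode:
  assumes "recursive_fun f" and "recursive_fun g"
  shows "recursive_fun (\<lambda>x. prod_encode (f x, g x))"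
  unfolding prod_encode_def using assms
  by (simp add: recursive_fun_add recursive_fun_triangle)

lemma recursive_on_prod_encode: "recursive_on 2 (\<lambda>xs. prod_encode (xs ! 0, xs ! 1))"
proof -
  have "recursive_on 2 (\<lambda>xs. triangle (xs ! 0 + xs ! 1))"
    using recursive_on_comp1[OF recursive_on_triangle recursive_on_add] by simp
  then show ?thesis
    using recursive_on_comp2[OF recursive_on_add, of 2 "\<lambda>xs. triangle (xs ! 0 + xs ! 1)" "\<lambda>xs. xs ! 0"]
    by (simp add: prod_encode_def recursive_on_nth)
qed

lemma ex_prod_code: "(\<exists>k. P (pfst k) (psnd k)) \<longleftrightarrow> (\<exists>i j. P i j)"
  by (metis fst_conv prod_encode_inverse snd_conv)

text \<open>The index \<open>m + n\<close> of the antidiagonal on which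
  \<open>z = prod_encode (m, n)\<close> lies: the codes on diagonals up to \<open>w\<close> are
  those below \<open>triangle (Suc w)\<close>. The truncated difference states this bound as an
  equation with 0, the form that minimization takes.\<close>

definition diagonal :: "nat \<Rightarrow> nat" where
  "diagonal z = (LEAST w. Suc z - triangle (Suc w) = 0)"

lemma triangle_mono: "m \<le> n \<Longrightarrow> triangle m \<le> triangle n"
  by (induction n) (auto simp: le_Suc_eq)

lemma le_triangle: "n \<le> triangle n"
  by (induction n) auto

lemma diagonal_prod_encode: "diagonal (prod_encode (m, n)) = m + n"
  unfolding diagonal_def
proof (rule Least_equality)
  show "Suc (prod_encode (m, n)) - triangle (Suc (m + n)) = 0"
    by (simp add: prod_encode_def)
next
  fix w assume w: "Suc (prod_encode (m, n)) - triangle (Suc w) = 0"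
  show "m + n \<le> w"
  proof (rule ccontr)
    assume "\<not> m + n \<le> w"
    then have "triangle (Suc w) \<le> triangle (m + n)"
      by (intro triangle_mono) simp
    with w show False
      by (simp add: prod_encode_def)
  qed
qed

lemma recursive_fun_diagonal: "recursive_fun diagonal"
proof -
  have 1: "recursive_on 2 (\<lambda>xs. triangle (Suc (xs ! 0)))"
    using recursive_on_comp1[OF recursive_on_triangle, of 2 "\<lambda>xs. Suc (xs ! 0)"]
    by (simp add: recursive_on_nth recursive_on_Suc)
  have 2: "recursive_on (Suc 1) (\<lambda>xs. Suc (xs ! 1) - triangle (Suc (xs ! 0)))"
    using recursive_on_comp2[OF recursive_on_diff _ 1, of "\<lambda>xs. Suc (xs ! 1)"]
    by (simp add: recursive_on_nth recursive_on_Suc numeral_2_eq_2)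
  \<comment> \<open>The search succeeds at \<open>w = z\<close> at the latest, since
    \<open>le_triangle\<close> gives \<open>Suc z \<le> triangle (Suc z)\<close>.\<close>
  show ?thesis
    unfolding recursive_fun_iff diagonal_def
    using recursive_on_Least[OF 2] le_triangle
    by (simp del: triangle_Suc) blast
qed

text \<open>The code of \<open>(m, n)\<close> is \<open>triangle (m + n) + m\<close>, so removing
  the triangle leaves \<open>m\<close>, and the rest of the diagonal index is
  \<open>n\<close>.\<close>

lemma pfst_eq: "pfst z = z - triangle (diagonal z)"
  and psnd_eq: "psnd z = diagonal z - pfst z"
proof -
  obtain m n where z: "z = prod_encode (m, n)"
    by (metis prod_decode_inverse surj_pair)
  show "pfst z = z - triangle (diagonal z)" "psnd z = diagonal z - pfst z"
    unfolding z diagonal_prod_encode by simp_all (simp add: prod_encode_def)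
qed

lemma recursive_fun_pfst: "recursive_fun f \<Longrightarrow> recursive_fun (\<lambda>x. pfst (f x))"
  unfolding pfst_eq
  by (intro recursive_fun_diff recursive_fun_triangle recursive_fun_comp[OF recursive_fun_diagonal])

lemma recursive_fun_psnd: "recursive_fun f \<Longrightarrow> recursive_fun (\<lambda>x. psnd (f x))"
  unfolding psnd_eq
  by (intro recursive_fun_diff recursive_fun_pfst recursive_fun_comp[OF recursive_fun_diagonal])

lemmas recursive_fun_intros = recursive_fun_id recursive_fun_const recursive_fun_Suc
  recursive_fun_add recursive_fun_mult recursive_fun_diff recursive_fun_power2
  recursive_fun_prod_encode recursive_fun_pfst recursive_fun_psnd

lemma recursive_fun_Least_zero:
  assumes "recursive_fun (\<lambda>z. f (pfst z) (psnd z))" and "\<And>x. \<exists>k. f x k = 0"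
  shows "recursive_fun (\<lambda>x. LEAST k. f x k = 0)"
proof -
  \<comment> \<open>Minimization expects the search variable first, while \<open>f\<close> takes it
    second.\<close>
  have "recursive_on 2 (\<lambda>xs. prod_encode (xs ! 1, xs ! 0))"
    using recursive_on_comp2[OF recursive_on_prod_encode, of 2 "\<lambda>xs. xs ! 1" "\<lambda>xs. xs ! 0"]
    by (simp add: recursive_on_nth)
  from recursive_on_comp1[OF assms(1)[unfolded recursive_fun_iff] this]
  have "recursive_on (Suc 1) (\<lambda>xs. f (xs ! 1) (xs ! 0))"
    by (simp add: numeral_2_eq_2)
  from recursive_on_Least[OF this] assms(2) show ?thesis
    unfolding recursive_fun_iff by simp
qed

section \<open>Decidable predicates and bounded quantifiers\<close>

definition decidable :: "(nat \<Rightarrow> bool) \<Rightarrow> bool" where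
  "decidable P \<longleftrightarrow> recursive_fun (\<lambda>x. of_bool (P x))"

lemma decidable_not: "decidable P \<Longrightarrow> decidable (\<lambda>x. \<not> P x)"
proof -
  have "of_bool (\<not> P x) = 1 - (of_bool (P x) :: nat)" for x
    by simp
  then show "decidable P \<Longrightarrow> decidable (\<lambda>x. \<not> P x)"
    unfolding decidable_def by (simp only:) (intro recursive_fun_intros)
qed

lemma decidable_conj: "decidable P \<Longrightarrow> decidable Q \<Longrightarrow> decidable (\<lambda>x. P x \<and> Q x)"
  unfolding decidable_def of_bool_conj by (intro recursive_fun_intros)

lemma decidable_imp: "decidable P \<Longrightarrow> decidable Q \<Longrightarrow> decidable (\<lambda>x. P x \<longrightarrow> Q x)"
  using decidable_not[OF decidable_conj[OF _ decidable_not[of Q]], of P] by simp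

lemma decidable_disj: "decidable P \<Longrightarrow> decidable Q \<Longrightarrow> decidable (\<lambda>x. P x \<or> Q x)"
  using decidable_imp[OF decidable_not[of P], of Q] by (simp add: disj_imp)

lemma decidable_less:
  assumes "recursive_fun f" and "recursive_fun g"
  shows "decidable (\<lambda>x. f x < g x)"
proof -
  have "of_bool (f x < g x) = 1 - (1 - (g x - f x))" for x
    by auto
  then show ?thesis
    unfolding decidable_def using assms by (simp only:) (intro recursive_fun_intros)
qed

lemma decidable_le: "recursive_fun f \<Longrightarrow> recursive_fun g \<Longrightarrow> decidable (\<lambda>x. f x \<le> g x)"
  using decidable_not[OF decidable_less[of g f]] by (simp add: not_less)

lemma decidable_eq: "recursive_fun f \<Longrightarrow> recursive_fun g \<Longrightarrow> decidable (\<lambda>x. f x = g x)"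
  unfolding order_eq_iff by (intro decidable_conj decidable_le)

lemma recursive_fun_Least:
  assumes "decidable (\<lambda>z. P (pfst z) (psnd z))" and "\<And>x. \<exists>k. P x k"
  shows "recursive_fun (\<lambda>x. LEAST k. P x k)"
  using recursive_fun_Least_zero[OF decidable_not[OF assms(1), unfolded decidable_def]] assms(2)
  by simp

lemma decidable_all_less:
  assumes "decidable (\<lambda>z. P (pfst z) (psnd z))" and "recursive_fun b"
  shows "decidable (\<lambda>x. \<forall>k<b x. P x k)"
proof -
  \<comment> \<open>The first counterexample, or the bound if none precedes it; the disjunct
    \<open>b x \<le> k\<close> makes the search total. The quantifier holds iff the search reaches
    the bound.\<close>
  define m where "m x = (LEAST k. b x \<le> k \<or> \<not> P x k)" for x
  have ex: "\<exists>k. b x \<le> k \<or> \<not> P x k" for x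
    by blast
  have "recursive_fun m"
    unfolding m_def
    by (intro recursive_fun_Least decidable_disj decidable_le decidable_not assms(1) ex
        recursive_fun_comp[OF assms(2)] recursive_fun_intros)
  moreover have "(\<forall>k<b x. P x k) \<longleftrightarrow> b x \<le> m x" for x
  proof
    assume "\<forall>k<b x. P x k"
    then show "b x \<le> m x"
      using LeastI_ex[OF ex, of x] unfolding m_def by (meson leI)
  next
    assume "b x \<le> m x"
    then show "\<forall>k<b x. P x k"
      using not_less_Least[of _ "\<lambda>k. b x \<le> k \<or> \<not> P x k"] unfolding m_def
      by (meson order_less_le_trans)
  qed
  ultimately show ?thesis
    using assms(2) by (simp add: decidable_le)
qed

lemma decidable_ex_less:
  assumes "decidable (\<lambda>z. P (pfst z) (psnd z))" and "recursive_fun b"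
  shows "decidable (\<lambda>x. \<exists>k<b x. P x k)"
  using decidable_not[OF decidable_all_less[OF decidable_not[OF assms(1)] assms(2)]] by simp

text \<open>Bit \<open>k\<close> of \<open>m\<close> is set iff \<open>m div 2 ^ k\<close> is odd.
  Quotient and remainder appear under bounded quantifiers, so that sums, products and powers of 2
  suffice for decidability.\<close>

lemma set_decode_iff_ex:
  "k \<in> set_decode m \<longleftrightarrow> (\<exists>q<Suc m. \<exists>r<2 ^ k. m = (2 * q + 1) * 2 ^ k + r)"
proof
  assume "k \<in> set_decode m"
  then have "odd (m div 2 ^ k)"
    by (simp add: set_decode_def)
  then obtain q where q: "m div 2 ^ k = 2 * q + 1"
    by (elim oddE)
  have "m div 2 ^ k \<le> m"
    by (rule div_le_dividend)
  with q have "q < Suc m"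
    by linarith
  moreover have "m = (2 * q + 1) * 2 ^ k + m mod 2 ^ k"
    using div_mult_mod_eq[of m "2 ^ k"] unfolding q by simp
  moreover have "m mod 2 ^ k < 2 ^ k"
    by simp
  ultimately show "\<exists>q<Suc m. \<exists>r<2 ^ k. m = (2 * q + 1) * 2 ^ k + r"
    by blast
next
  assume "\<exists>q<Suc m. \<exists>r<2 ^ k. m = (2 * q + 1) * 2 ^ k + r"
  then obtain q r where "r < 2 ^ k" and m: "m = (2 * q + 1) * 2 ^ k + r"
    by blast
  then have "m div 2 ^ k = 2 * q + 1"
    by (simp only: m div_mult_self3) simp
  then show "k \<in> set_decode m"
    by (simp add: set_decode_def)
qed

text \<open>Since \<open>k < 2 ^ k\<close>, a code bounds the elements of its set, so quantifiers
  over a coded set are bounded ones.\<close>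

lemma set_decode_less: "k \<in> set_decode m \<Longrightarrow> k < m"
  unfolding set_decode_def
  by simp (metis div_less even_zero less_exp not_less order_less_le_trans)

lemma decidable_in_set_decode:
  assumes "recursive_fun f" and "recursive_fun g"
  shows "decidable (\<lambda>x. f x \<in> set_decode (g x))"
  unfolding set_decode_iff_ex
  by (intro decidable_ex_less decidable_eq recursive_fun_intros
      recursive_fun_comp[OF assms(1)] recursive_fun_comp[OF assms(2)])

lemma Ball_set_decode: "(\<forall>k\<in>set_decode m. P k) \<longleftrightarrow> (\<forall>k<m. k \<in> set_decode m \<longrightarrow> P k)"
  using set_decode_less by blast

lemma decidable_Ball_set_decode:
  assumes "decidable (\<lambda>z. P (pfst z) (psnd z))" and "recursive_fun b"
  shows "decidable (\<lambda>x. \<forall>k\<in>set_decode (b x). P x k)"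
  unfolding Ball_set_decode
  by (intro decidable_all_less decidable_imp decidable_in_set_decode assms
      recursive_fun_comp[OF assms(2)] recursive_fun_intros)

lemmas decidable_intros = decidable_not decidable_conj decidable_imp decidable_disj
  decidable_less decidable_le decidable_eq decidable_all_less decidable_ex_less
  decidable_in_set_decode decidable_Ball_set_decode

section \<open>Recursively enumerable sets\<close>

text \<open>Trades enumerations for one existential quantifier over a decidable relation. The empty
  set is then no special case, and closure properties become manipulations of quantifiers.\<close>

lemma re_iff_projection:
  "recursively_enumerable S \<longleftrightarrow>
    (\<exists>R. decidable (\<lambda>z. R (pfst z) (psnd z)) \<and> (\<forall>x. x \<in> S \<longleftrightarrow> (\<exists>k. R x k)))"
proof
  assume "recursively_enumerable S"
  then consider "S = {}" | f where "recursive_fun f" "S = range f"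
    unfolding recursively_enumerable_def by blast
  then show "\<exists>R. decidable (\<lambda>z. R (pfst z) (psnd z)) \<and> (\<forall>x. x \<in> S \<longleftrightarrow> (\<exists>k. R x k))"
  proof cases
    case 1
    then show ?thesis
      by (intro exI[of _ "\<lambda>x k. False"]) (simp add: decidable_def recursive_fun_const)
  next
    case 2
    then show ?thesis
      by (intro exI[of _ "\<lambda>x k. x = f k"])
        (auto intro!: decidable_intros recursive_fun_intros recursive_fun_comp[OF 2(1)])
  qed
next
  assume "\<exists>R. decidable (\<lambda>z. R (pfst z) (psnd z)) \<and> (\<forall>x. x \<in> S \<longleftrightarrow> (\<exists>k. R x k))"
  then obtain R where R: "decidable (\<lambda>z. R (pfst z) (psnd z))"
    and S: "\<And>x. x \<in> S \<longleftrightarrow> (\<exists>k. R x k)"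
    by blast
  show "recursively_enumerable S"
  proof (cases "S = {}")
    case False
    then obtain a where a: "a \<in> S"
      by blast
    \<comment> \<open>Pairs \<open>(x, k)\<close> that violate \<open>R\<close> yield the fixed
      element \<open>a\<close> of \<open>S\<close>, which keeps \<open>f\<close> total with range
      inside \<open>S\<close>. The case distinction is written arithmetically to be visibly
      recursive.\<close>
    define f where "f z = of_bool (R (pfst z) (psnd z)) * pfst z +
      of_bool (\<not> R (pfst z) (psnd z)) * a" for z
    have f: "f z = (if R (pfst z) (psnd z) then pfst z else a)" for z
      unfolding f_def by simp
    have "recursive_fun f"
      unfolding f_def using R decidable_not[OF R]
      by (intro recursive_fun_intros) (simp_all add: decidable_def)
    moreover have "S = range f"
    proof (intro set_eqI iffI)
      fix x assume "x \<in> S"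
      then obtain k where "R x k"
        using S by blast
      then have "x = f (prod_encode (x, k))"
        by (simp add: f)
      then show "x \<in> range f"
        by blast
    next
      fix x assume "x \<in> range f"
      then show "x \<in> S"
        using a S unfolding f by (auto split: if_splits)
    qed
    ultimately show ?thesis
      unfolding recursively_enumerable_def by blast
  qed (simp add: recursively_enumerable_def)
qed

lemma re_decidable: "decidable P \<Longrightarrow> recursively_enumerable {x. P x}"
  unfolding re_iff_projection
  by (intro exI[of _ "\<lambda>x k. P x"])
    (simp add: decidable_def recursive_fun_comp[of "\<lambda>x. of_bool (P x)"] recursive_fun_intros)

text \<open>The quantified \<open>k\<close> and the witness \<open>j\<close> for membership are
  packed into one number by pairing.\<close>

lemma re_Collect_ex:
  assumes "recursively_enumerable {z. P (pfst z) (psnd z)}"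
  shows "recursively_enumerable {x. \<exists>k. P x k}"
proof -
  obtain R where R: "decidable (\<lambda>z. R (pfst z) (psnd z))"
    and P: "\<And>z. P (pfst z) (psnd z) \<longleftrightarrow> (\<exists>j. R z j)"
    using assms unfolding re_iff_projection by auto
  have P': "P x = (\<lambda>k. \<exists>j. R (prod_encode (x, k)) j)" for x
    by (rule ext) (use P[of "prod_encode (x, k)" for k] in simp)
  have "recursive_fun (\<lambda>z. prod_encode (prod_encode (pfst z, pfst (psnd z)), psnd (psnd z)))"
    by (intro recursive_fun_intros)
  from recursive_fun_comp[OF R[unfolded decidable_def] this]
  have "decidable (\<lambda>z. R (prod_encode (pfst z, pfst (psnd z))) (psnd (psnd z)))"
    by (simp add: decidable_def)
  then show ?thesis
    unfolding re_iff_projection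
    by (intro exI[of _ "\<lambda>x k. R (prod_encode (x, pfst k)) (psnd k)"])
      (simp add: P' ex_prod_code[of "\<lambda>i j. R (prod_encode (x, i)) j" for x])
qed

lemma re_comp:
  assumes "recursively_enumerable S" and "recursive_fun f"
  shows "recursively_enumerable {x. f x \<in> S}"
proof -
  obtain R where R: "decidable (\<lambda>z. R (pfst z) (psnd z))"
    and S: "\<And>x. x \<in> S \<longleftrightarrow> (\<exists>j. R x j)"
    using assms(1) unfolding re_iff_projection by auto
  have "recursive_fun (\<lambda>z. prod_encode (f (pfst z), psnd z))"
    by (intro recursive_fun_intros recursive_fun_comp[OF assms(2)])
  from recursive_fun_comp[OF R[unfolded decidable_def] this] show ?thesis
    unfolding re_iff_projection
    by (intro exI[of _ "\<lambda>x. R (f x)"]) (simp add: S decidable_def)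
qed

lemma re_Un:
  assumes "recursively_enumerable S" and "recursively_enumerable T"
  shows "recursively_enumerable (S \<union> T)"
proof -
  obtain Q R where Q: "decidable (\<lambda>z. Q (pfst z) (psnd z))" "\<And>x. x \<in> S \<longleftrightarrow> (\<exists>j. Q x j)"
    and R: "decidable (\<lambda>z. R (pfst z) (psnd z))" "\<And>x. x \<in> T \<longleftrightarrow> (\<exists>j. R x j)"
    using assms unfolding re_iff_projection by auto
  \<comment> \<open>Existential quantifiers distribute over disjunction, so a common witness serves
    both relations.\<close>
  show ?thesis
    unfolding re_iff_projection
    by (intro exI[of _ "\<lambda>x k. Q x k \<or> R x k"]) (auto simp: Q R intro: decidable_disj)
qed

text \<open>The two conjuncts may need different witnesses, hence a pair of them.\<close>

lemma re_conj:
  assumes "recursively_enumerable {x. P x}" and "recursively_enumerable {x. Q x}"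
  shows "recursively_enumerable {x. P x \<and> Q x}"
proof -
  obtain P' Q' where P': "decidable (\<lambda>z. P' (pfst z) (psnd z))" "\<And>x. P x \<longleftrightarrow> (\<exists>j. P' x j)"
    and Q': "decidable (\<lambda>z. Q' (pfst z) (psnd z))" "\<And>x. Q x \<longleftrightarrow> (\<exists>j. Q' x j)"
    using assms unfolding re_iff_projection by auto
  have "decidable (\<lambda>z. P' (pfst z) (pfst (psnd z)))"
    using recursive_fun_comp[OF P'(1)[unfolded decidable_def],
        of "\<lambda>z. prod_encode (pfst z, pfst (psnd z))"]
    by (simp add: decidable_def recursive_fun_intros)
  moreover have "decidable (\<lambda>z. Q' (pfst z) (psnd (psnd z)))"
    using recursive_fun_comp[OF Q'(1)[unfolded decidable_def],
        of "\<lambda>z. prod_encode (pfst z, psnd (psnd z))"]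
    by (simp add: decidable_def recursive_fun_intros)
  ultimately show ?thesis
    unfolding re_iff_projection
    by (intro exI[of _ "\<lambda>x k. P' x (pfst k) \<and> Q' x (psnd k)"])
      (simp add: P'(2) Q'(2) ex_prod_code[of "\<lambda>i j. P' x i \<and> Q' x j" for x] decidable_conj)
qed

section \<open>Enumeration operators\<close>

lemma re_finite_UN:
  "finite I \<Longrightarrow> (\<And>i. i \<in> I \<Longrightarrow> recursively_enumerable (E i)) \<Longrightarrow> recursively_enumerable (\<Union>i\<in>I. E i)"
  by (induction I rule: finite_induct) (auto simp: recursively_enumerable_def[of "{}"] re_Un)

lemma enum_operator_UN: "enum_operator (\<Union>i\<in>I. E i) B = (\<Union>i\<in>I. enum_operator (E i) B)"
  unfolding enum_operator_def by blast

lemma ex_re_enum_operator_Int: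
  assumes "recursively_enumerable E" and "recursively_enumerable F"
  shows "\<exists>G. recursively_enumerable G \<and>
    (\<forall>B. enum_operator G B = enum_operator E B \<inter> enum_operator F B)"
proof (intro exI conjI allI)
  \<comment> \<open>An axiom of the intersection asks for a finite set that includes the finite sets
    of an \<open>E\<close>-axiom and of an \<open>F\<close>-axiom with the same output.\<close>
  let ?G = "{w. \<exists>i j. prod_encode (pfst w, i) \<in> E \<and> prod_encode (pfst w, j) \<in> F \<and>
    (\<forall>a\<in>set_decode i. a \<in> set_decode (psnd w)) \<and> (\<forall>a\<in>set_decode j. a \<in> set_decode (psnd w))}"
  show "recursively_enumerable ?G"
    by (intro re_Collect_ex re_conj re_comp[OF assms(1)] re_comp[OF assms(2)] re_decidable
        decidable_intros recursive_fun_intros)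
  fix B
  show "enum_operator ?G B = enum_operator E B \<inter> enum_operator F B"
  proof (intro set_eqI iffI)
    fix z assume "z \<in> enum_operator ?G B"
    then show "z \<in> enum_operator E B \<inter> enum_operator F B"
      unfolding enum_operator_def by auto
  next
    fix z assume "z \<in> enum_operator E B \<inter> enum_operator F B"
    then obtain i j where "prod_encode (z, i) \<in> E" "prod_encode (z, j) \<in> F"
      and "set_decode i \<subseteq> B" "set_decode j \<subseteq> B"
      unfolding enum_operator_def by blast
    \<comment> \<open>The union of the two finite sets is the condition of the joint axiom.\<close>
    moreover have "set_decode (set_encode (set_decode i \<union> set_decode j)) = set_decode i \<union> set_decode j"
      by simp
    ultimately show "z \<in> enum_operator ?G B"
      unfolding enum_operator_def
      by (intro CollectI exI[of _ "set_encode (set_decode i \<union> set_decode j)"]) auto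
  qed
qed

text \<open>Iterates binary intersection, with \<open>F\<close> as the start of the induction.
  Below, \<open>F\<close> restricts the intersection to the points of a separating set.\<close>

lemma ex_re_enum_operator_INT:
  assumes "finite I" and "\<forall>i\<in>I. recursively_enumerable (E i)" and "recursively_enumerable F"
  shows "\<exists>G. recursively_enumerable G \<and>
    (\<forall>B. enum_operator G B = (\<Inter>i\<in>I. enum_operator (E i) B) \<inter> enum_operator F B)"
  using assms(1,2)
proof (induction I rule: finite_induct)
  case empty
  then show ?case
    using assms(3) by auto
next
  case (insert i I)
  then obtain G where "recursively_enumerable G"
    and G: "\<And>B. enum_operator G B = (\<Inter>i\<in>I. enum_operator (E i) B) \<inter> enum_operator F B"
    by auto
  with ex_re_enum_operator_Int[of "E i" G] insert.prems show ?case
    by (auto simp: Int_assoc)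
qed

section \<open>Recursive operators against enumeration operators\<close>

lemma eq_Collect_prod_encode: "S = {prod_encode (n, l) |n l. prod_encode (n, l) \<in> S}"
proof (intro set_eqI iffI)
  fix z assume "z \<in> S"
  then show "z \<in> {prod_encode (n, l) |n l. prod_encode (n, l) \<in> S}"
    by (intro CollectI exI[of _ "pfst z"] exI[of _ "psnd z"]) simp
qed auto

text \<open>
  On a stage \<open>s\<close> coding \<open>(j, t)\<close>, the operator checks the \<open>j\<close>-th axiom of \<open>E\<close> against the first
  \<open>t + 1\<close> values of the name.  An axiom that applies does so at arbitrarily late stages, so taking
  the first successful stage from \<open>n\<close> on gives a total result that misses no value.
\<close>

lemma ex_recursive_operator_of_enum_operator:
  assumes "recursively_enumerable E"
  shows "\<exists>\<Gamma>. recursive_operator \<Gamma> \<and>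
    (\<forall>g. enum_operator E (range g) \<noteq> {} \<longrightarrow>
      (\<exists>h. \<Gamma> g = (\<lambda>n. Some (h n)) \<and> range h = enum_operator E (range g)))"
proof (cases "E = {}")
  case True
  \<comment> \<open>With \<open>E\<close> empty no name has a nonempty output, so the nowhere
    defined operator serves.\<close>
  have "recursive_operator (\<lambda>g n. None)"
    unfolding recursive_operator_def
    by (intro exI[of _ "{}"]) (simp add: recursively_enumerable_def enum_operator_def)
  with True show ?thesis
    by (auto simp: enum_operator_def)
next
  case False
  with assms obtain e where e: "recursive_fun e" "E = range e"
    unfolding recursively_enumerable_def by blast
  define hits where "hits g s \<longleftrightarrow> (\<forall>v\<in>set_decode (psnd (e (pfst s))). \<exists>i<Suc (psnd s). g i = v)"
    for g :: "nat \<Rightarrow> nat" and s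
  define out where "out s = pfst (e (pfst s))" for s
  define \<Gamma> where "\<Gamma> g n = (if \<exists>s\<ge>n. hits g s then Some (out (LEAST s. n \<le> s \<and> hits g s)) else None)"
    for g n
  \<comment> \<open>\<open>fhits\<close> is \<open>hits\<close> read off a finite piece
    \<open>m\<close> of the graph of the name. \<open>covers\<close> makes this piece decide all
    arguments up to \<open>s\<close>, so that failures of earlier stages can be read off too. The
    bound \<open>v < m\<close> loses nothing, as \<open>v\<close> is at most the pair code, which
    lies below \<open>m\<close>.\<close>
  define fhits where "fhits m s \<longleftrightarrow> (\<forall>v\<in>set_decode (psnd (e (pfst s))). \<exists>i<Suc (psnd s).
    prod_encode (i, v) \<in> set_decode m)" for m s
  define covers where "covers m s \<longleftrightarrow> (\<forall>i<Suc s. \<exists>v<m. prod_encode (i, v) \<in> set_decode m)" for m s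
  define P where "P n l m s \<longleftrightarrow> covers m s \<and> n \<le> s \<and> fhits m s \<and> l = out s \<and>
    (\<forall>k<s. n \<le> k \<longrightarrow> \<not> fhits m k)" for n l m s
  define W where "W = {w. \<exists>s. P (pfst (pfst w)) (psnd (pfst w)) (psnd w) s}"
  have "recursively_enumerable W"
    unfolding W_def P_def fhits_def covers_def out_def
    by (intro re_Collect_ex re_decidable decidable_intros recursive_fun_comp[OF e(1)]
        recursive_fun_intros)
  moreover have "{prod_encode (n, l) |n l. \<Gamma> g n = Some l} =
      enum_operator W {prod_encode (n, g n) |n. True}" (is "?L = enum_operator W ?graph") for g
  proof -
    \<comment> \<open>Stage \<open>k\<close> consults arguments up to \<open>psnd k\<close> only,
      and \<open>psnd k \<le> k \<le> s\<close>, so the piece covers them.\<close>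
    have fhits_iff: "fhits m k \<longleftrightarrow> hits g k"
      if m: "set_decode m \<subseteq> ?graph" and cov: "covers m s" and k: "k \<le> s" for m s k
    proof -
      have "prod_encode (i, v) \<in> set_decode m \<longleftrightarrow> g i = v" if i: "i < Suc (psnd k)" for i v
      proof
        assume "prod_encode (i, v) \<in> set_decode m"
        with m show "g i = v"
          by auto
      next
        assume "g i = v"
        have "psnd k \<le> k"
          using le_prod_encode_2[of "psnd k" "pfst k"] by simp
        with i k have "i < Suc s"
          by linarith
        with cov obtain v' where "prod_encode (i, v') \<in> set_decode m"
          unfolding covers_def by blast
        with m \<open>g i = v\<close> show "prod_encode (i, v) \<in> set_decode m"
          by auto
      qed
      then have "(\<exists>i<Suc (psnd k). prod_encode (i, v) \<in> set_decode m) \<longleftrightarrow>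
          (\<exists>i<Suc (psnd k). g i = v)" for v
        by blast
      then show ?thesis
        unfolding fhits_def hits_def by simp
    qed
    have "\<Gamma> g n = Some l \<longleftrightarrow> (\<exists>m. prod_encode (prod_encode (n, l), m) \<in> W \<and> set_decode m \<subseteq> ?graph)"
      (is "_ \<longleftrightarrow> ?R") for n l
    proof
      assume \<Gamma>: "\<Gamma> g n = Some l"
      define s where "s = (LEAST s. n \<le> s \<and> hits g s)"
      from \<Gamma> have ex: "\<exists>s. n \<le> s \<and> hits g s" and l: "l = out s"
        unfolding \<Gamma>_def s_def by (auto split: if_splits)
      have s: "n \<le> s" "hits g s"
        using LeastI_ex[OF ex] unfolding s_def by auto
      have before: "\<not> hits g k" if "k < s" "n \<le> k" for k
        using that not_less_Least unfolding s_def by blast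
      \<comment> \<open>The graph of \<open>g\<close> up to the successful stage determines the
        whole search.\<close>
      define m where "m = set_encode ((\<lambda>i. prod_encode (i, g i)) ` {..s})"
      have m: "set_decode m = (\<lambda>i. prod_encode (i, g i)) ` {..s}"
        unfolding m_def by simp
      have "covers m s"
        unfolding covers_def
      proof (intro allI impI)
        fix i assume "i < Suc s"
        then have "prod_encode (i, g i) \<in> set_decode m"
          unfolding m by auto
        moreover from set_decode_less[OF this] have "g i < m"
          using le_prod_encode_2[of "g i" i] by linarith
        ultimately show "\<exists>v<m. prod_encode (i, v) \<in> set_decode m"
          by blast
      qed
      moreover have sub: "set_decode m \<subseteq> ?graph"
        unfolding m by auto
      ultimately have "P n l m s"
        unfolding P_def using s l before fhits_iff by auto
      with sub show ?R
        unfolding W_def by auto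
    next
      assume ?R
      then obtain m s where m: "set_decode m \<subseteq> ?graph" and "P n l m s"
        unfolding W_def by auto
      then have s: "n \<le> s" "hits g s" "l = out s" "\<And>k. k < s \<Longrightarrow> n \<le> k \<Longrightarrow> \<not> hits g k"
        unfolding P_def using fhits_iff by auto
      from s have "(LEAST s. n \<le> s \<and> hits g s) = s"
        by (intro Least_equality) (auto simp: not_less[symmetric])
      with s show "\<Gamma> g n = Some l"
        unfolding \<Gamma>_def by auto
    qed
    then have "\<Gamma> g n = Some l \<longleftrightarrow> prod_encode (n, l) \<in> enum_operator W ?graph" for n l
      by (simp add: enum_operator_def)
    then show ?thesis
      using eq_Collect_prod_encode[of "enum_operator W ?graph"] by simp
  qed
  ultimately have "recursive_operator \<Gamma>"
    unfolding recursive_operator_def by blast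
  moreover have "\<exists>h. \<Gamma> g = (\<lambda>n. Some (h n)) \<and> range h = enum_operator E (range g)"
    if nonempty: "enum_operator E (range g) \<noteq> {}" for g
  proof -
    have out_mem: "out s \<in> enum_operator E (range g)" if "hits g s" for s
      using that unfolding out_def hits_def enum_operator_def e(2)
      by (auto intro!: exI[of _ "psnd (e (pfst s))"])
    have late: "\<exists>s\<ge>n. hits g s \<and> out s = l" if l: "l \<in> enum_operator E (range g)" for l n
    proof -
      from l obtain m j where j: "e j = prod_encode (l, m)" and m: "set_decode m \<subseteq> range g"
        unfolding enum_operator_def e(2) by (auto simp: image_iff eq_commute[of _ "e _"])
      from m have "set_decode m \<subseteq> g ` (\<Union>t. {..t})"
        by auto
      then obtain X where X: "finite X" "set_decode m = g ` X"
        using finite_subset_image[OF finite_set_decode m] by blast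
      \<comment> \<open>Late enough to pass all positions in \<open>X\<close>, where the name lists
        the axiom's finite set, and to make the stage at least \<open>n\<close>. Inserting 0 keeps
        \<open>Max\<close> meaningful for empty \<open>X\<close>.\<close>
      define t where "t = max n (Max (insert 0 X))"
      have "i \<le> t" if "i \<in> X" for i
        using that X(1) unfolding t_def by (simp add: max.coboundedI2)
      then have "hits g (prod_encode (j, t))"
        unfolding hits_def by (auto simp: j X(2) less_Suc_eq_le)
      moreover have "n \<le> prod_encode (j, t)"
        using le_prod_encode_2[of t j] unfolding t_def by linarith
      moreover have "out (prod_encode (j, t)) = l"
        unfolding out_def by (simp add: j)
      ultimately show ?thesis
        by blast
    qed
    define first where "first n = (LEAST s. n \<le> s \<and> hits g s)" for n
    obtain l where "l \<in> enum_operator E (range g)"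
      using nonempty by blast
    from late[OF this] have ex: "\<exists>s. n \<le> s \<and> hits g s" for n
      by blast
    have first: "hits g (first n)" for n
      using LeastI_ex[OF ex] unfolding first_def by blast
    have "\<Gamma> g = (\<lambda>n. Some (out (first n)))"
      unfolding \<Gamma>_def first_def using ex by (intro ext) simp
    moreover have "range (\<lambda>n. out (first n)) = enum_operator E (range g)"
    proof (intro set_eqI iffI)
      fix l assume "l \<in> enum_operator E (range g)"
      then obtain s where s: "hits g s" "out s = l"
        using late by blast
      \<comment> \<open>A successful stage \<open>s\<close> is found at once by the search that
        starts at \<open>s\<close>, so its output occurs as the value at \<open>s\<close>.\<close>
      then have "first s = s"
        unfolding first_def by (intro Least_equality) auto
      with s show "l \<in> range (\<lambda>n. out (first n))"
        by (metis rangeI)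
    qed (use first out_mem in auto)
    ultimately show ?thesis
      by (intro exI[of _ "\<lambda>n. out (first n)"]) simp
  qed
  ultimately show ?thesis
    by (intro exI[of _ \<Gamma>] conjI allI impI)
qed

lemma ex_range_extending:
  fixes I X :: "nat set"
  assumes "I \<noteq> {}" and "finite X" and "h ` X \<subseteq> I"
  shows "\<exists>g. range g = I \<and> (\<forall>n\<in>X. g n = h n)"
proof -
  obtain a where a: "a \<in> I"
    using assms(1) by blast
  obtain N where N: "\<forall>n\<in>X. n < N"
    using assms(2) unfolding finite_nat_set_iff_bounded by (elim exE)
  \<comment> \<open>Beyond the bound \<open>N\<close> of \<open>X\<close>, each \<open>i\<close> in
    \<open>I\<close> is listed at \<open>i + N\<close>; the default \<open>a\<close> keeps all other
    values in \<open>I\<close>.\<close>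
  define g where "g n = (if n \<in> X then h n else if n - N \<in> I then n - N else a)" for n
  have "i \<in> range g" if "i \<in> I" for i
  proof -
    have "g (i + N) = i"
      using that N unfolding g_def by auto
    then show ?thesis
      by (rule range_eqI[OF sym])
  qed
  moreover have "range g \<subseteq> I"
    using a assms(3) unfolding g_def by auto
  ultimately have "range g = I"
    by blast
  moreover have "\<forall>n\<in>X. g n = h n"
    by (simp add: g_def)
  ultimately show ?thesis
    by (intro exI[of _ g] conjI)
qed

text \<open>An output that \<open>\<Gamma>\<close> derives from a finite graph with values in
  \<open>I\<close> is correct, because that graph extends to an enumeration of \<open>I\<close>.
  Conversely, each output on an enumeration of \<open>I\<close> uses a finite part of it
  only.\<close>

lemma ex_enum_operator_of_recursive_operator:
  assumes "recursive_operator \<Gamma>"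
  shows "\<exists>E. recursively_enumerable E \<and>
    (\<forall>I J. I \<noteq> {} \<longrightarrow> (\<forall>g. range g = I \<longrightarrow> (\<exists>h. \<Gamma> g = (\<lambda>n. Some (h n)) \<and> range h = J)) \<longrightarrow>
      enum_operator E I = J)"
proof -
  obtain W where W: "recursively_enumerable W"
    and \<Gamma>: "\<And>g. {prod_encode (n, l) |n l. \<Gamma> g n = Some l} =
      enum_operator W {prod_encode (n, g n) |n. True}"
    using assms unfolding recursive_operator_def by blast
  have \<Gamma>_iff: "\<Gamma> g n = Some l \<longleftrightarrow>
      prod_encode (n, l) \<in> enum_operator W {prod_encode (n, g n) |n. True}" for g n l
    unfolding \<Gamma>[symmetric] by auto
  \<comment> \<open>Single-valuedness: a finite set violating it is part of no name, so its outputs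
    are under no control.\<close>
  define sv where "sv p \<longleftrightarrow> (\<forall>a\<in>set_decode p. \<forall>b\<in>set_decode p. pfst a = pfst b \<longrightarrow> psnd a = psnd b)" for p
  define E where "E = {w. \<exists>n p. prod_encode (prod_encode (n, pfst w), p) \<in> W \<and>
    sv p \<and> (\<forall>a\<in>set_decode p. psnd a \<in> set_decode (psnd w))}"
  have "recursively_enumerable E"
    unfolding E_def sv_def
    by (intro re_Collect_ex re_conj re_comp[OF W] re_decidable decidable_intros recursive_fun_intros)
  moreover have "enum_operator E I = J"
    if I: "I \<noteq> {}"
      and names: "\<And>g. range g = I \<Longrightarrow> \<exists>h. \<Gamma> g = (\<lambda>n. Some (h n)) \<and> range h = J" for I J
  proof (intro set_eqI iffI)
    fix l assume "l \<in> enum_operator E I"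
    then obtain m n p where m: "set_decode m \<subseteq> I"
      and p: "prod_encode (prod_encode (n, l), p) \<in> W" "sv p"
        "\<And>a. a \<in> set_decode p \<Longrightarrow> psnd a \<in> set_decode m"
      unfolding enum_operator_def E_def by auto
    \<comment> \<open>The finite function with graph \<open>p\<close>; \<open>sv p\<close> makes the
      choice unambiguous on its domain.\<close>
    define h where "h i = psnd (SOME a. a \<in> set_decode p \<and> pfst a = i)" for i
    have h: "h (pfst a) = psnd a" if a: "a \<in> set_decode p" for a
    proof -
      define b where "b = (SOME b. b \<in> set_decode p \<and> pfst b = pfst a)"
      have "b \<in> set_decode p \<and> pfst b = pfst a"
        unfolding b_def by (rule someI[of _ a]) (use a in simp)
      with p(2) a have "psnd b = psnd a"
        unfolding sv_def by blast
      then show ?thesis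
        unfolding h_def b_def .
    qed
    have "h ` pfst ` set_decode p \<subseteq> I"
    proof (intro subsetI, elim imageE)
      fix i j a assume "i = h j" "j = pfst a" "a \<in> set_decode p"
      with h p(3) m show "i \<in> I"
        by auto
    qed
    then obtain g where "range g = I" and g: "\<forall>n\<in>pfst ` set_decode p. g n = h n"
      using ex_range_extending[OF I, of "pfst ` set_decode p" h] by auto
    with names[of g] obtain h' where h': "\<Gamma> g = (\<lambda>n. Some (h' n))" "range h' = J"
      by (elim meta_impE exE conjE)
    have "a \<in> {prod_encode (n, g n) |n. True}" if "a \<in> set_decode p" for a
    proof -
      have "a = prod_encode (pfst a, g (pfst a))"
        using bspec[OF g imageI[OF that]] h[OF that] by simp
      then show ?thesis
        by blast
    qed
    then have "set_decode p \<subseteq> {prod_encode (n, g n) |n. True}"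
      by (rule subsetI)
    with p(1) have "\<Gamma> g n = Some l"
      unfolding \<Gamma>_iff enum_operator_def by (intro CollectI exI[of _ p] conjI)
    with h' show "l \<in> J"
      by auto
  next
    fix l assume l: "l \<in> J"
    obtain g :: "nat \<Rightarrow> nat" where g: "range g = I"
      using ex_range_extending[OF I, of "{}" id] by auto
    from names[OF this] l obtain n where "\<Gamma> g n = Some l"
      by auto
    then obtain p where p: "prod_encode (prod_encode (n, l), p) \<in> W"
      and sub: "set_decode p \<subseteq> {prod_encode (n, g n) |n. True}"
      unfolding \<Gamma>_iff enum_operator_def mem_Collect_eq by (elim exE conjE)
    have "sv p"
      unfolding sv_def
    proof (intro ballI impI)
      fix a b assume "a \<in> set_decode p" "b \<in> set_decode p" "pfst a = pfst b"
      moreover have "psnd c = g (pfst c)" if "c \<in> set_decode p" for c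
        using sub that by auto
      ultimately show "psnd a = psnd b"
        by simp
    qed
    moreover have "psnd ` set_decode p \<subseteq> I"
      using sub g by fastforce
    \<comment> \<open>Positions are forgotten: the axiom of \<open>E\<close> asks only for the
      values that the computation used.\<close>
    moreover have "set_decode (set_encode (psnd ` set_decode p)) = psnd ` set_decode p"
      by simp
    ultimately show "l \<in> enum_operator E I"
      unfolding enum_operator_def E_def using p
      by (intro CollectI exI[of _ "set_encode (psnd ` set_decode p)"]) auto
  qed
  ultimately show ?thesis
    by (intro exI[of _ E] conjI allI impI) (assumption | simp)+
qed

text \<open>Eliminates names in favour of index sets. The nonemptiness conditions of the two
  conversions hold because \<open>x\<close> and \<open>y\<close> lie in the unions of
  \<open>U\<close> and \<open>V\<close>.\<close>

lemma computable_fun_iff_enum_operator: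
  "computable_fun U V f \<longleftrightarrow> dom f \<subseteq> (\<Union>k. U k) \<and> ran f \<subseteq> (\<Union>l. V l) \<and>
    (\<exists>E. recursively_enumerable E \<and>
      (\<forall>x y. f x = Some y \<longrightarrow> enum_operator E (indices U x) = indices V y))" (is "?L \<longleftrightarrow> ?R")
proof
  assume ?L
  then obtain \<Gamma> where f: "dom f \<subseteq> (\<Union>k. U k)" "ran f \<subseteq> (\<Union>l. V l)" and "recursive_operator \<Gamma>"
    and names: "\<And>x y g. f x = Some y \<Longrightarrow> is_name U x g \<Longrightarrow>
        \<exists>h. \<Gamma> g = (\<lambda>n. Some (h n)) \<and> is_name V y h"
    unfolding computable_fun_def by blast
  from ex_enum_operator_of_recursive_operator[OF this(3)]
  obtain E where "recursively_enumerable E"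
    and E: "\<forall>I J. I \<noteq> {} \<longrightarrow> (\<forall>g. range g = I \<longrightarrow>
      (\<exists>h. \<Gamma> g = (\<lambda>n. Some (h n)) \<and> range h = J)) \<longrightarrow> enum_operator E I = J"
    by (elim exE conjE)
  moreover have "enum_operator E (indices U x) = indices V y" if xy: "f x = Some y" for x y
  proof (rule E[rule_format])
    have x: "x \<in> (\<Union>k. U k)"
      using f(1) xy by blast
    then show "indices U x \<noteq> {}"
      by (auto simp: indices_def)
    show "\<exists>h. \<Gamma> g = (\<lambda>n. Some (h n)) \<and> range h = indices V y" if "range g = indices U x" for g
      using names[OF xy, of g] x that unfolding is_name_def by blast
  qed
  ultimately show ?R
    using f by blast
next
  assume ?R
  then obtain E where f: "dom f \<subseteq> (\<Union>k. U k)" "ran f \<subseteq> (\<Union>l. V l)" and "recursively_enumerable E"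
    and E: "\<And>x y. f x = Some y \<Longrightarrow> enum_operator E (indices U x) = indices V y"
    by blast
  from ex_recursive_operator_of_enum_operator[OF this(3)]
  obtain \<Gamma> where "recursive_operator \<Gamma>"
    and \<Gamma>: "\<forall>g. enum_operator E (range g) \<noteq> {} \<longrightarrow>
      (\<exists>h. \<Gamma> g = (\<lambda>n. Some (h n)) \<and> range h = enum_operator E (range g))"
    by (elim exE conjE)
  moreover have "\<exists>h. \<Gamma> g = (\<lambda>n. Some (h n)) \<and> is_name V y h"
    if xy: "f x = Some y" and g: "is_name U x g" for x y g
  proof -
    have y: "y \<in> (\<Union>l. V l)"
      using f(2) xy by (auto simp: ran_def)
    have "enum_operator E (range g) = indices V y"
      using E[OF xy] g unfolding is_name_def by simp
    moreover have "indices V y \<noteq> {}"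
      using y by (auto simp: indices_def)
    ultimately show ?thesis
      using \<Gamma>[rule_format, of g] y unfolding is_name_def by auto
  qed
  ultimately show ?L
    unfolding computable_fun_def using f by blast
qed

section \<open>Join permission and separation\<close>

text \<open>Links the two notions: lying in \<open>hat U m\<close> is the condition for an axiom
  with finite set \<open>m\<close> to apply to \<open>indices U x\<close>. The convention for the
  empty intersection fits the empty condition.\<close>

lemma in_hat_iff: "x \<in> (\<Union>k. U k) \<Longrightarrow> x \<in> hat U m \<longleftrightarrow> set_decode m \<subseteq> indices U x"
  unfolding hat_def indices_def by auto

lemma hat_subset: "hat U m \<subseteq> (\<Union>k. U k)"
  unfolding hat_def by auto

lemma effective_union_enum_operator:
  assumes "recursively_enumerable E"
  shows "effective_union (hat U) {x \<in> (\<Union>k. U k). l \<in> enum_operator E (indices U x)}"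
  unfolding effective_union_def
\<comment> \<open>The index set consists of the conditions of all axioms with output
  \<open>l\<close>.\<close>
proof (intro exI[of _ "{m. prod_encode (l, m) \<in> E}"] conjI set_eqI iffI)
  show "recursively_enumerable {m. prod_encode (l, m) \<in> E}"
    by (intro re_comp[OF assms] recursive_fun_intros)
next
  fix x assume "x \<in> {x \<in> (\<Union>k. U k). l \<in> enum_operator E (indices U x)}"
  then show "x \<in> (\<Union>m\<in>{m. prod_encode (l, m) \<in> E}. hat U m)"
    by (auto simp: enum_operator_def in_hat_iff)
next
  fix x assume "x \<in> (\<Union>m\<in>{m. prod_encode (l, m) \<in> E}. hat U m)"
  then obtain m where "prod_encode (l, m) \<in> E" and x: "x \<in> hat U m"
    by blast
  with hat_subset[of U m] in_hat_iff[of x U m]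
  show "x \<in> {x \<in> (\<Union>k. U k). l \<in> enum_operator E (indices U x)}"
    by (auto simp: enum_operator_def)
qed

text \<open>Every number is attached as output to every \<open>m\<close> in \<open>S\<close>.
  Intersecting with this all-or-nothing operator switches another one off outside
  \<open>H\<close>.\<close>

lemma effective_union_ex_enum_operator:
  assumes "effective_union (hat U) H"
  shows "\<exists>E. recursively_enumerable E \<and>
    (\<forall>x\<in>(\<Union>k. U k). enum_operator E (indices U x) = (if x \<in> H then UNIV else {}))"
proof -
  obtain S where S: "recursively_enumerable S" and H: "H = (\<Union>m\<in>S. hat U m)"
    using assms unfolding effective_union_def by blast
  have "recursively_enumerable {w. psnd w \<in> S}"
    by (intro re_comp[OF S] recursive_fun_intros)
  moreover have "enum_operator {w. psnd w \<in> S} (indices U x) = (if x \<in> H then UNIV else {})"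
    if "x \<in> (\<Union>k. U k)" for x
    unfolding H enum_operator_def using in_hat_iff[OF that] by auto
  ultimately show ?thesis
    by blast
qed

lemma computable_fun_const:
  assumes "computable_element V y" and "dom f \<subseteq> (\<Union>k. U k)" and "ran f \<subseteq> {y}"
  shows "computable_fun U V f"
  unfolding computable_fun_iff_enum_operator
proof (intro conjI exI[of _ "{w. pfst w \<in> indices V y}"] allI impI)
  have "recursively_enumerable (indices V y)"
    using assms(1) by (simp add: computable_element_def)
  then show "recursively_enumerable {w. pfst w \<in> indices V y}"
    by (intro re_comp recursive_fun_intros)
  fix x z assume "f x = Some z"
  with assms(3) have "z = y"
    by (auto simp: ran_def)
  then show "enum_operator {w. pfst w \<in> indices V y} (indices U x) = indices V z"
    \<comment> \<open>The code 0 denotes the empty set, a condition that every index set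
      meets.\<close>
    by (auto simp: enum_operator_def intro!: exI[of _ 0])
qed (use assms in \<open>auto simp: computable_element_def\<close>)

lemma strongly_join_permitting_if_separable:
  fixes U :: "nat \<Rightarrow> 'a set" and V :: "nat \<Rightarrow> 'b set"
  assumes fin: "finite \<A>" and sub: "\<forall>A\<in>\<A>. A \<subseteq> (\<Union>k. U k)"
    and sep: "\<forall>\<K>\<subseteq>\<A>. \<exists>H. effective_union (hat U) H \<and>
      separates H (\<Union>\<K> - \<Union>(\<A> - \<K>)) (\<Union>(\<A> - \<K>) - \<Union>\<K>)"
  shows "strongly_join_permitting {f :: 'a \<rightharpoonup> 'b. computable_fun U V f} \<A>"
  unfolding strongly_join_permitting_def
proof (intro allI impI)
  fix f :: "'a \<rightharpoonup> 'b"
  assume dom: "dom f \<subseteq> \<Union>\<A>" and "\<forall>A\<in>\<A>. f |` A \<in> {f. computable_fun U V f}"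
  then have restr: "computable_fun U V (f |` A)" if "A \<in> \<A>" for A
    using that by blast
  then have "\<forall>A\<in>\<A>. \<exists>E. recursively_enumerable E \<and>
      (\<forall>x y. (f |` A) x = Some y \<longrightarrow> enum_operator E (indices U x) = indices V y)"
    unfolding computable_fun_iff_enum_operator by blast
  from bchoice[OF this] obtain E where
    "\<forall>A\<in>\<A>. recursively_enumerable (E A) \<and>
      (\<forall>x y. (f |` A) x = Some y \<longrightarrow> enum_operator (E A) (indices U x) = indices V y)"
    by (elim exE)
  then have E_re: "\<And>A. A \<in> \<A> \<Longrightarrow> recursively_enumerable (E A)"
    and E: "\<And>A x y. A \<in> \<A> \<Longrightarrow> x \<in> A \<Longrightarrow> f x = Some y \<Longrightarrow>
      enum_operator (E A) (indices U x) = indices V y"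
    by simp_all
  from sep have "\<forall>\<K>\<in>Pow \<A>. \<exists>H. effective_union (hat U) H \<and>
      separates H (\<Union>\<K> - \<Union>(\<A> - \<K>)) (\<Union>(\<A> - \<K>) - \<Union>\<K>)"
    by simp
  from bchoice[OF this] obtain H where "\<forall>\<K>\<in>Pow \<A>. effective_union (hat U) (H \<K>) \<and>
      separates (H \<K>) (\<Union>\<K> - \<Union>(\<A> - \<K>)) (\<Union>(\<A> - \<K>) - \<Union>\<K>)"
    by (elim exE)
  then have H: "\<And>\<K>. \<K> \<subseteq> \<A> \<Longrightarrow> effective_union (hat U) (H \<K>)"
    and H_sep: "\<And>\<K>. \<K> \<subseteq> \<A> \<Longrightarrow>
      separates (H \<K>) (\<Union>\<K> - \<Union>(\<A> - \<K>)) (\<Union>(\<A> - \<K>) - \<Union>\<K>)"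
    by simp_all
  \<comment> \<open>For empty \<open>\<K>\<close> the intersection is \<open>UNIV\<close>, which is
    harmless because \<open>H {}\<close> is disjoint from \<open>\<Union>\<A>\<close>.\<close>
  have "\<forall>\<K>\<in>Pow \<A>. \<exists>G. recursively_enumerable G \<and> (\<forall>x\<in>(\<Union>k. U k).
      enum_operator G (indices U x) =
      (if x \<in> H \<K> then (\<Inter>A\<in>\<K>. enum_operator (E A) (indices U x)) else {}))"
  proof
    fix \<K> assume \<K>: "\<K> \<in> Pow \<A>"
    then have \<K>': "\<K> \<subseteq> \<A>"
      by simp
    from effective_union_ex_enum_operator[OF H[OF \<K>']] obtain F where "recursively_enumerable F"
      and F: "\<forall>x\<in>(\<Union>k. U k). enum_operator F (indices U x) = (if x \<in> H \<K> then UNIV else {})"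
      by (elim exE conjE)
    have "\<forall>A\<in>\<K>. recursively_enumerable (E A)"
      using \<K>' E_re by blast
    from ex_re_enum_operator_INT[OF finite_subset[OF \<K>' fin] this \<open>recursively_enumerable F\<close>]
    obtain G where "recursively_enumerable G"
      and "\<forall>B. enum_operator G B = (\<Inter>A\<in>\<K>. enum_operator (E A) B) \<inter> enum_operator F B"
      by (elim exE conjE)
    with F show "\<exists>G. recursively_enumerable G \<and> (\<forall>x\<in>(\<Union>k. U k).
        enum_operator G (indices U x) =
        (if x \<in> H \<K> then (\<Inter>A\<in>\<K>. enum_operator (E A) (indices U x)) else {}))"
      by (intro exI[of _ G]) simp
  qed
  from bchoice[OF this] obtain G where "\<forall>\<K>\<in>Pow \<A>. recursively_enumerable (G \<K>) \<and>
      (\<forall>x\<in>(\<Union>k. U k). enum_operator (G \<K>) (indices U x) =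
      (if x \<in> H \<K> then (\<Inter>A\<in>\<K>. enum_operator (E A) (indices U x)) else {}))"
    by (elim exE)
  then have G_re: "\<And>\<K>. \<K> \<in> Pow \<A> \<Longrightarrow> recursively_enumerable (G \<K>)"
    and G: "\<And>\<K> x. \<K> \<in> Pow \<A> \<Longrightarrow> x \<in> (\<Union>k. U k) \<Longrightarrow> enum_operator (G \<K>) (indices U x) =
      (if x \<in> H \<K> then (\<Inter>A\<in>\<K>. enum_operator (E A) (indices U x)) else {})"
    by (blast dest: bspec)+
  have "recursively_enumerable (\<Union>\<K>\<in>Pow \<A>. G \<K>)"
    by (intro re_finite_UN G_re) (use fin in auto)
  moreover have "enum_operator (\<Union>\<K>\<in>Pow \<A>. G \<K>) (indices U x) = indices V y"
    if xy: "f x = Some y" for x y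
  proof -
    obtain A where A: "A \<in> \<A>" "x \<in> A"
      using dom xy by blast
    then have x: "x \<in> (\<Union>k. U k)"
      using sub by blast
    show ?thesis
      unfolding enum_operator_UN
    proof (intro equalityI UN_least)
      fix \<K> assume \<K>: "\<K> \<in> Pow \<A>"
      show "enum_operator (G \<K>) (indices U x) \<subseteq> indices V y"
      proof (cases "x \<in> H \<K>")
        case True
        \<comment> \<open>If no member of \<open>\<K>\<close> contained \<open>x\<close>, then
          \<open>A\<close> would be in \<open>\<A> - \<K>\<close>, and \<open>x\<close> in the set
          that \<open>H \<K>\<close> avoids.\<close>
        with H_sep[of \<K>] \<K> A obtain B where "B \<in> \<K>" "x \<in> B"
          unfolding separates_def by blast
        with True E[OF _ _ xy, of B] \<K> show ?thesis
          unfolding G[OF \<K> x] by auto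
      qed (simp add: G[OF \<K> x])
    next
      define \<K> where "\<K> = {B \<in> \<A>. x \<in> B}"
      have \<K>: "\<K> \<in> Pow \<A>"
        unfolding \<K>_def by blast
      \<comment> \<open>No set outside this \<open>\<K>\<close> contains \<open>x\<close>, while
        \<open>A\<close> belongs to it.\<close>
      have "x \<in> H \<K>"
        using H_sep[of \<K>] A unfolding separates_def \<K>_def by blast
      moreover have "enum_operator (E B) (indices U x) = indices V y" if "B \<in> \<K>" for B
        using that E[OF _ _ xy] unfolding \<K>_def by blast
      ultimately have "indices V y \<subseteq> enum_operator (G \<K>) (indices U x)"
        unfolding G[OF \<K> x] by auto
      with \<K> show "indices V y \<subseteq> (\<Union>\<K>\<in>Pow \<A>. enum_operator (G \<K>) (indices U x))"
        by blast
    qed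
  qed
  moreover have "ran f \<subseteq> (\<Union>l. V l)"
  proof
    fix y assume "y \<in> ran f"
    then obtain x where xy: "f x = Some y"
      by (auto simp: ran_def)
    with dom obtain A where A: "A \<in> \<A>" "x \<in> A"
      by blast
    with xy have "y \<in> ran (f |` A)"
      by (auto intro!: ranI[of _ x])
    with restr[OF A(1)] show "y \<in> (\<Union>l. V l)"
      unfolding computable_fun_def by blast
  qed
  moreover have "dom f \<subseteq> (\<Union>k. U k)"
    using dom sub by blast
  ultimately show "f \<in> {f. computable_fun U V f}"
    unfolding computable_fun_iff_enum_operator by blast
qed

lemma separable_if_strongly_join_permitting:
  fixes U :: "nat \<Rightarrow> 'a set" and V :: "nat \<Rightarrow> 'b set"
  assumes sub: "\<forall>A\<in>\<A>. A \<subseteq> (\<Union>k. U k)"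
    and y1: "computable_element V y1" "y1 \<in> V l" and y2: "computable_element V y2" "y2 \<notin> V l"
    and join: "strongly_join_permitting {f :: 'a \<rightharpoonup> 'b. computable_fun U V f} \<A>"
    and \<K>: "\<K> \<subseteq> \<A>"
  shows "\<exists>H. effective_union (hat U) H \<and>
    separates H (\<Union>\<K> - \<Union>(\<A> - \<K>)) (\<Union>(\<A> - \<K>) - \<Union>\<K>)"
proof -
  define P Q where "P = \<Union>\<K> - \<Union>(\<A> - \<K>)" and "Q = \<Union>(\<A> - \<K>) - \<Union>\<K>"
  define f where "f x = (if x \<in> P then Some y1 else if x \<in> Q then Some y2 else None)" for x
  have f1: "f x = Some y1" if "x \<in> P" for x
    using that unfolding f_def by simp
  have "P \<inter> Q = {}"
    unfolding P_def Q_def by blast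
  then have f2: "f x = Some y2" if "x \<in> Q" for x
    using that unfolding f_def by auto
  have "dom f \<subseteq> P \<union> Q"
    unfolding f_def dom_def by auto
  moreover have "P \<union> Q \<subseteq> \<Union>\<A>"
    using \<K> unfolding P_def Q_def by blast
  ultimately have dom: "dom f \<subseteq> \<Union>\<A>"
    by (rule subset_trans)
  have "computable_fun U V (f |` A)" if A: "A \<in> \<A>" for A
  proof -
    have domA: "dom (f |` A) \<subseteq> (\<Union>k. U k)"
      using A sub by auto
    show ?thesis
    proof (cases "A \<in> \<K>")
      case True
      \<comment> \<open>\<open>A\<close> is included in \<open>\<Union>\<K>\<close>, which
        \<open>Q\<close> misses, so the restriction takes no value but \<open>y1\<close>. The other
        case is symmetric.\<close>
      then have "x \<notin> Q" if "x \<in> A" for x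
        using that unfolding Q_def by blast
      then have "ran (f |` A) \<subseteq> {y1}"
        by (auto simp: ran_def f_def restrict_map_def split: if_splits)
      with y1(1) domA show ?thesis
        by (rule computable_fun_const)
    next
      case False
      with A have "x \<notin> P" if "x \<in> A" for x
        using that unfolding P_def by blast
      then have "ran (f |` A) \<subseteq> {y2}"
        by (auto simp: ran_def f_def restrict_map_def split: if_splits)
      with y2(1) domA show ?thesis
        by (rule computable_fun_const)
    qed
  qed
  with join dom have "computable_fun U V f"
    unfolding strongly_join_permitting_def by blast
  then obtain E where E: "recursively_enumerable E"
    "\<And>x y. f x = Some y \<Longrightarrow> enum_operator E (indices U x) = indices V y"
    unfolding computable_fun_iff_enum_operator by blast
  \<comment> \<open>On \<open>P\<close> the operator enumerates the indices of \<open>y1\<close>,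
    among them \<open>l\<close>; on \<open>Q\<close> those of \<open>y2\<close>, where
    \<open>l\<close> is missing.\<close>
  define H where "H = {x \<in> (\<Union>k. U k). l \<in> enum_operator E (indices U x)}"
  have "x \<in> H" if "x \<in> P" for x
  proof -
    have "x \<in> (\<Union>k. U k)"
      using f1[OF that] dom sub by blast
    with E(2)[OF f1[OF that]] y1(2) show ?thesis
      unfolding H_def indices_def by simp
  qed
  moreover have "x \<notin> H" if "x \<in> Q" for x
    using E(2)[OF f2[OF that]] y2(2) unfolding H_def indices_def by simp
  ultimately have "separates H P Q"
    unfolding separates_def by blast
  moreover have "effective_union (hat U) H"
    unfolding H_def using E(1) by (rule effective_union_enum_operator)
  ultimately show ?thesis
    unfolding P_def Q_def by blast
qed

theorem theorem4p2:
  fixes U :: "nat \<Rightarrow> 'a set" and V :: "nat \<Rightarrow> 'b set" and C :: "('a \<rightharpoonup> 'b) set"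
    and \<A> :: "'a set set"
  assumes C: "C = {f. computable_fun U V f}"
    and fin: "finite \<A>"
    and sub: "\<forall>A\<in>\<A>. A \<subseteq> (\<Union>k. U k)"
  shows "((\<forall>\<K>\<subseteq>\<A>. \<exists>H. effective_union (hat U) H \<and>
            separates H (\<Union>\<K> - \<Union>(\<A> - \<K>)) (\<Union>(\<A> - \<K>) - \<Union>\<K>))
          \<longrightarrow> strongly_join_permitting C \<A>) \<and>
         ((\<exists>l1 l2. (\<exists>y\<in>V l1. computable_element V y) \<and>
                   (\<exists>y\<in>V l2 - V l1. computable_element V y)) \<longrightarrow>
          strongly_join_permitting C \<A> \<longrightarrow>
          (\<forall>\<K>\<subseteq>\<A>. \<exists>H. effective_union (hat U) H \<and>
            separates H (\<Union>\<K> - \<Union>(\<A> - \<K>)) (\<Union>(\<A> - \<K>) - \<Union>\<K>)))"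
proof (intro conjI impI allI)
  assume "\<forall>\<K>\<subseteq>\<A>. \<exists>H. effective_union (hat U) H \<and>
    separates H (\<Union>\<K> - \<Union>(\<A> - \<K>)) (\<Union>(\<A> - \<K>) - \<Union>\<K>)"
  then show "strongly_join_permitting C \<A>"
    unfolding C by (rule strongly_join_permitting_if_separable[OF fin sub])
next
  fix \<K>
  assume "\<exists>l1 l2. (\<exists>y\<in>V l1. computable_element V y) \<and> (\<exists>y\<in>V l2 - V l1. computable_element V y)"
    and join: "strongly_join_permitting C \<A>" and \<K>: "\<K> \<subseteq> \<A>"
  \<comment> \<open>The distinguishing index \<open>l\<close> is \<open>l1\<close>.\<close>
  then obtain l y1 y2 where "computable_element V y1" "y1 \<in> V l" "computable_element V y2" "y2 \<notin> V l"
    by blast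
  then show "\<exists>H. effective_union (hat U) H \<and>
    separates H (\<Union>\<K> - \<Union>(\<A> - \<K>)) (\<Union>(\<A> - \<K>) - \<Union>\<K>)"
    using separable_if_strongly_join_permitting[OF sub _ _ _ _ join[unfolded C] \<K>] by simp
qed

end
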